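(* Let $(T,\Sigma,\mu)$ be a complete $\sigma$-finite measure space, let $Z$ be a separable Banach space, let $1\le p<\infty$, and let $S:T\rightrightarrows Z$ be a measurable multifunction with nonempty closed values. If $x\in \mathsf{Sel}_p(S)$, then $$\widehat{\mathbf T}_{\mathsf{Sel}_p(S)}(x)=\{v\in L^p(T,Z): v(t)\in \widehat{\mathbf T}_{S(t)}(x(t))\ \text{for a.e. } t\in T\}.$$
   Context: $L^p(T,Z)$ is the Lebesgue--Bochner space. A multifunction $S:T\rightrightarrows Z$ with nonempty closed values is measurable if $\{t\in T: S(t)\cap U\neq\emptyset\}\in\Sigma$ for every open $U\subset Z$. $\mathsf{Sel}_p(S):=\{z\in L^p(T,Z): z(t)\in S(t)\text{ a.e.}\}$. Clarke tangent cone: for a Banach space $X$ with closed unit ball $\overline{\mathbf B}_X$, a closed set $C\subset X$ and $x\in C$, the cone $\widehat{\mathbf T}_C(x)$ is the set of all $v\in X$ such that for every $\varepsilon>0$ there exist $\delta>0$ and $\lambda>0$ such that $C\cap[y+\eta(v+\varepsilon\overline{\mathbf B}_X)]\ne\emptyset$ for every $y\in C\cap(x+\delta\overline{\mathbf B}_X)$ and every $\eta\in[0,\lambda]$. The cone on the left is taken in $L^p(T,Z)$; the cones on the right are taken in $Z$. *)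

theory Defs
  imports "HOL-Analysis.Analysis"
begin

text \<open>
  The Lebesgue--Bochner spaces depend on a measure and an exponent, which are terms, so they
  cannot be types.  A normed space is therefore given here by an explicit carrier with its
  operations, which lets one definition of the Clarke tangent cone serve both for such a space
  and for a Banach space that is a type.
\<close>

record 'x normed_struct =
  vectors :: "'x set"
  vadd :: "'x \<Rightarrow> 'x \<Rightarrow> 'x"
  vscale :: "real \<Rightarrow> 'x \<Rightarrow> 'x"
  vnorm :: "'x \<Rightarrow> real"

definition type_space :: "'z::real_normed_vector normed_struct" where
  "type_space = \<lparr>vectors = UNIV, vadd = (+), vscale = (*\<^sub>R), vnorm = norm\<rparr>"

definition unit_cball :: "'x normed_struct \<Rightarrow> 'x set" where
  "unit_cball X = {b \<in> vectors X. vnorm X b \<le> 1}"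

text \<open>The set \<open>a + r B\<close>, where \<open>B\<close> is the closed unit ball.\<close>

definition shifted_cball :: "'x normed_struct \<Rightarrow> 'x \<Rightarrow> real \<Rightarrow> 'x set" where
  "shifted_cball X a r = (\<lambda>b. vadd X a (vscale X r b)) ` unit_cball X"

definition clarke_cone :: "'x normed_struct \<Rightarrow> 'x set \<Rightarrow> 'x \<Rightarrow> 'x set" where
  "clarke_cone X C x = {v \<in> vectors X. \<forall>\<epsilon>>0. \<exists>\<delta>>0. \<exists>\<kappa>>0.
     \<forall>y \<in> C \<inter> shifted_cball X x \<delta>. \<forall>\<eta>\<in>{0..\<kappa>}.
       C \<inter> (\<lambda>w. vadd X y (vscale X \<eta> w)) ` shifted_cball X v \<epsilon> \<noteq> {}}"

lemma shifted_cball_type_space: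
  fixes a :: "'z::real_normed_vector"
  assumes "r > 0"
  shows "shifted_cball type_space a r = cball a r"
proof -
  have "\<exists>b. y = a + r *\<^sub>R b \<and> norm b \<le> 1" if "y \<in> cball a r" for y
    using that assms
    by (intro exI[of _ "(1 / r) *\<^sub>R (y - a)"]) (auto simp: dist_norm norm_minus_commute)
  moreover have "a + r *\<^sub>R b \<in> cball a r" if "norm b \<le> 1" for b
    using that assms by (simp add: dist_norm mult_left_le)
  ultimately show ?thesis
    by (simp add: shifted_cball_def unit_cball_def type_space_def image_def set_eq_iff) blast
qed

lemma clarke_cone_type_space:
  fixes C :: "'z::real_normed_vector set"
  shows "clarke_cone type_space C x = {v. \<forall>\<epsilon>>0. \<exists>\<delta>>0. \<exists>\<kappa>>0.
     \<forall>y \<in> C \<inter> cball x \<delta>. \<forall>\<eta>\<in>{0..\<kappa>}. C \<inter> (\<lambda>w. y + \<eta> *\<^sub>R w) ` cball v \<epsilon> \<noteq> {}}"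
proof -
  have "vectors type_space = (UNIV :: 'z set)" "vadd type_space = ((+) :: 'z \<Rightarrow> _)"
    "vscale type_space = ((*\<^sub>R) :: _ \<Rightarrow> 'z \<Rightarrow> _)"
    by (simp_all add: type_space_def)
  then show ?thesis
    unfolding clarke_cone_def by (simp add: shifted_cball_type_space cong: conj_cong)
qed

text \<open>
  For second-countable (i.e. separable) \<open>'z\<close>, Borel measurability is Bochner's strong
  measurability.
\<close>

definition Lp_fun :: "real \<Rightarrow> 't measure \<Rightarrow> ('t \<Rightarrow> 'z::{banach, second_countable_topology}) set"
  where "Lp_fun p M = {f \<in> borel_measurable M. integrable M (\<lambda>t. norm (f t) powr p)}"

definition ae_eq :: "real \<Rightarrow> 't measure \<Rightarrow>
    (('t \<Rightarrow> 'z) \<times> ('t \<Rightarrow> 'z::{banach, second_countable_topology})) set"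
  where "ae_eq p M = {(f, g). f \<in> Lp_fun p M \<and> g \<in> Lp_fun p M \<and> (AE t in M. f t = g t)}"

definition Lp_class :: "real \<Rightarrow> 't measure \<Rightarrow> ('t \<Rightarrow> 'z::{banach, second_countable_topology}) \<Rightarrow>
    ('t \<Rightarrow> 'z) set"
  where "Lp_class p M f = ae_eq p M `` {f}"

text \<open>
  A fixed but arbitrary representative of a class; below it enters only into properties that
  do not depend on the choice.
\<close>

definition rep :: "('t \<Rightarrow> 'z) set \<Rightarrow> 't \<Rightarrow> 'z" where
  "rep u = (SOME f. f \<in> u)"

definition Lp :: "real \<Rightarrow> 't measure \<Rightarrow>
    ('t \<Rightarrow> 'z::{banach, second_countable_topology}) set normed_struct"
  where "Lp p M = \<lparr>vectors = Lp_fun p M // ae_eq p M,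
     vadd = (\<lambda>u v. Lp_class p M (\<lambda>t. rep u t + rep v t)),
     vscale = (\<lambda>c u. Lp_class p M (\<lambda>t. c *\<^sub>R rep u t)),
     vnorm = (\<lambda>u. (\<integral>t. norm (rep u t) powr p \<partial>M) powr (1 / p))\<rparr>"

lemma equiv_ae_eq: "equiv (Lp_fun p M) (ae_eq p M)"
proof -
  have "AE t in M. f t = h t" if "AE t in M. f t = g t" "AE t in M. g t = h t"
    for f g h :: "'a \<Rightarrow> 'b"
    using that by eventually_elim simp
  moreover have "AE t in M. g t = f t" if "AE t in M. f t = g t" for f g :: "'a \<Rightarrow> 'b"
    using that by eventually_elim simp
  ultimately show ?thesis
    unfolding equiv_def refl_on_def sym_def trans_def ae_eq_def by blast
qed

lemma rep_in:
  assumes "u \<in> vectors (Lp p M)"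
  shows "rep u \<in> u" and "rep u \<in> Lp_fun p M" and "Lp_class p M (rep u) = u"
proof -
  have u: "u \<in> Lp_fun p M // ae_eq p M"
    using assms by (simp add: Lp_def)
  then show 1: "rep u \<in> u"
    unfolding rep_def using in_quotient_imp_non_empty[OF equiv_ae_eq u] by (simp add: some_in_eq)
  then show "rep u \<in> Lp_fun p M"
    using in_quotient_imp_subset[OF equiv_ae_eq u] by blast
  show "Lp_class p M (rep u) = u"
    using u 1 unfolding Lp_class_def
    by (metis Image_singleton_iff equiv_ae_eq equiv_class_eq quotientE)
qed

lemma rep_Lp_class:
  assumes "f \<in> Lp_fun p M"
  shows "Lp_class p M f \<in> vectors (Lp p M)" and "AE t in M. rep (Lp_class p M f) t = f t"
proof -
  show 1: "Lp_class p M f \<in> vectors (Lp p M)"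
    using assms by (simp add: Lp_def Lp_class_def quotientI)
  have "(f, rep (Lp_class p M f)) \<in> ae_eq p M"
    using rep_in(1)[OF 1] by (simp add: Lp_class_def)
  then show "AE t in M. rep (Lp_class p M f) t = f t"
    by (auto simp: ae_eq_def elim!: eventually_mono)
qed

definition measurable_multifunction ::
    "'t measure \<Rightarrow> ('t \<Rightarrow> 'z::topological_space set) \<Rightarrow> bool"
  where "measurable_multifunction M S \<longleftrightarrow>
     (\<forall>t\<in>space M. S t \<noteq> {} \<and> closed (S t)) \<and>
     (\<forall>U. open U \<longrightarrow> {t \<in> space M. S t \<inter> U \<noteq> {}} \<in> sets M)"

definition Sel :: "real \<Rightarrow> 't measure \<Rightarrow> ('t \<Rightarrow> 'z::{banach, second_countable_topology} set) \<Rightarrow>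
    ('t \<Rightarrow> 'z) set set"
  where "Sel p M S = {z \<in> vectors (Lp p M). AE t in M. rep z t \<in> S t}"

end

theory Submission
  imports Defs
begin

text \<open>
  The key point is that \<open>v\<close> lies in the Clarke cone of \<open>C\<close> at \<open>x\<close> as soon as, on one fixed
  ball around \<open>x\<close>, the points \<open>y + \<eta> v\<close> with \<open>y \<in> C\<close> are within \<open>\<eta> \<epsilon>\<close> of \<open>C\<close> for arbitrarily
  small \<open>\<eta>\<close>: a longer step is composed of many short ones.  Hence if the condition fails at \<open>t\<close>,
  it fails for every sufficiently small \<open>\<eta>\<close>, so on a set of positive finite measure one and the
  same \<open>\<eta>\<close> is bad for at least half of the points, and a measurable selection of bad base points
  \<open>y(t)\<close> contradicts the condition in \<open>L\<^sup>p\<close>.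

  Conversely, given a selection \<open>y\<close> close to \<open>x\<close> in \<open>L\<^sup>p\<close>, take a selection near \<open>y + \<eta> v\<close> where the
  pointwise condition holds uniformly and \<open>y(t)\<close> is close to \<open>x(t)\<close>, and \<open>y\<close> itself elsewhere.
  The error \<open>\<eta> |v|\<close> committed elsewhere has small norm: off a set where \<open>v\<close> has small norm, \<open>v\<close> is
  bounded by a multiple of \<open>y - x\<close>.
\<close>

subsection \<open>Short steps and the Clarke cone\<close>

definition clarke_good :: "'z::real_normed_vector set \<Rightarrow> 'z \<Rightarrow> 'z \<Rightarrow> real \<Rightarrow> real \<Rightarrow> real \<Rightarrow> bool" where
  "clarke_good C x v r \<eta> \<epsilon> \<longleftrightarrow> (\<forall>y \<in> C \<inter> ball x r. infdist (y + \<eta> *\<^sub>R v) C \<le> \<eta> * \<epsilon>)"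

lemma infdist_lessE:
  assumes "infdist z C < q" "C \<noteq> {}"
  obtains y where "y \<in> C" "dist z y < q"
proof -
  have "(INF a\<in>C. dist z a) < q" using assms by (simp add: infdist_def)
  then show ?thesis
    using assms(2) that cINF_less_iff[of C "dist z" q] by (auto intro: bdd_belowI2[where m=0])
qed

lemma clarke_good_multistep:
  assumes freq: "\<exists>\<^sub>F n in sequentially. clarke_good C x v r (inverse (Suc n)) \<epsilon>"
    and "\<epsilon> > 0" and y: "y \<in> C" "dist x y < s"
    and \<eta>: "0 < \<eta>" "\<eta> \<le> s" and s: "s * (1 + norm v + 2 * \<epsilon>) \<le> r"
  shows "infdist (y + \<eta> *\<^sub>R v) C \<le> 3 * \<eta> * \<epsilon>"
proof -
  have "((\<lambda>n. inverse (real (Suc n)) * norm v) \<longlongrightarrow> 0 * norm v) sequentially"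
    by (intro tendsto_intros LIMSEQ_inverse_real_of_nat)
  then have "\<forall>\<^sub>F n in sequentially. inverse (real (Suc n)) * norm v < \<eta> * \<epsilon>"
    using order_tendstoD(2)[of _ 0 sequentially "\<eta> * \<epsilon>"] assms by simp
  then have "\<exists>n. clarke_good C x v r (inverse (Suc n)) \<epsilon> \<and> inverse (real (Suc n)) * norm v < \<eta> * \<epsilon>"
    using frequently_eventually_frequently[OF freq] frequently_ex by blast
  then obtain h where h: "h > 0" "clarke_good C x v r h \<epsilon>" "h * norm v < \<eta> * \<epsilon>"
    by (metis inverse_positive_iff_positive of_nat_0_less_iff zero_less_Suc)
  define N where "N = nat \<lfloor>\<eta> / h\<rfloor>"
  have "real N = of_int \<lfloor>\<eta> / h\<rfloor>" unfolding N_def using h \<eta> by simp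
  then have "real N \<le> \<eta> / h" "\<eta> / h < real N + 1" by linarith+
  then have N: "real N * h \<le> \<eta>" "\<eta> - real N * h \<le> h"
    using h by (simp_all add: field_simps)
  have "\<exists>u\<in>C. norm (u - y - (real k * h) *\<^sub>R v) \<le> real k * h * (2 * \<epsilon>)" if "k \<le> N" for k
    using that
  proof (induction k)
    case 0
    then show ?case using y by auto
  next
    case (Suc k)
    then obtain u where u: "u \<in> C" "norm (u - y - (real k * h) *\<^sub>R v) \<le> real k * h * (2 * \<epsilon>)"
      by auto
    have "real k * h \<le> real N * h" using Suc.prems h by (intro mult_right_mono) auto
    then have k: "real k * h \<le> s" using N \<eta> by linarith
    have "dist x u \<le> dist x y + norm (u - y)"
      by (metis dist_triangle dist_commute dist_norm)
    also have "norm (u - y) \<le> norm (u - y - (real k * h) *\<^sub>R v) + norm ((real k * h) *\<^sub>R v)"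
      by (metis diff_add_cancel norm_triangle_ineq)
    also have "\<dots> \<le> real k * h * (2 * \<epsilon>) + real k * h * norm v"
      using u h by simp
    also have "\<dots> = real k * h * (norm v + 2 * \<epsilon>)"
      by (simp add: algebra_simps)
    also have "\<dots> \<le> s * (norm v + 2 * \<epsilon>)"
      using k \<open>\<epsilon> > 0\<close> by (intro mult_right_mono) auto
    finally have "dist x u < s * (1 + norm v + 2 * \<epsilon>)"
      using y(2) by (simp add: algebra_simps)
    then have "u \<in> C \<inter> ball x r" using s u by auto
    then have "infdist (u + h *\<^sub>R v) C \<le> h * \<epsilon>" using h(2) by (auto simp: clarke_good_def)
    also have "h * \<epsilon> < h * (2 * \<epsilon>)" using h \<open>\<epsilon> > 0\<close> by simp
    finally obtain w where w: "w \<in> C" "dist (u + h *\<^sub>R v) w < h * (2 * \<epsilon>)"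
      using infdist_lessE u(1) by blast
    have "w - y - (real (Suc k) * h) *\<^sub>R v
        = (w - (u + h *\<^sub>R v)) + (u - y - (real k * h) *\<^sub>R v)"
      by (simp add: algebra_simps)
    also have "norm \<dots> \<le> h * (2 * \<epsilon>) + real k * h * (2 * \<epsilon>)"
      using w(2) u(2) by (intro norm_triangle_mono) (auto simp: dist_norm norm_minus_commute)
    finally show ?case using w(1) by (intro bexI[of _ w]) (auto simp: algebra_simps)
  qed
  then obtain u where u: "u \<in> C" "norm (u - y - (real N * h) *\<^sub>R v) \<le> real N * h * (2 * \<epsilon>)"
    by blast
  have "infdist (y + \<eta> *\<^sub>R v) C \<le> dist (y + \<eta> *\<^sub>R v) u"
    using u(1) by (rule infdist_le)
  also have "\<dots> = norm ((\<eta> - real N * h) *\<^sub>R v - (u - y - (real N * h) *\<^sub>R v))"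
    by (simp add: dist_norm algebra_simps)
  also have "\<dots> \<le> norm ((\<eta> - real N * h) *\<^sub>R v) + norm (u - y - (real N * h) *\<^sub>R v)"
    by (rule norm_triangle_ineq4)
  also have "\<dots> \<le> h * norm v + \<eta> * (2 * \<epsilon>)"
  proof (rule add_mono)
    show "norm ((\<eta> - real N * h) *\<^sub>R v) \<le> h * norm v"
      using N by (simp add: mult_right_mono)
    have "real N * h * (2 * \<epsilon>) \<le> \<eta> * (2 * \<epsilon>)"
      using N(1) \<open>\<epsilon> > 0\<close> by (intro mult_right_mono) auto
    then show "norm (u - y - (real N * h) *\<^sub>R v) \<le> \<eta> * (2 * \<epsilon>)"
      using u(2) by linarith
  qed
  also have "\<dots> \<le> 3 * \<eta> * \<epsilon>" using h(3) by (simp add: algebra_simps)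
  finally show ?thesis .
qed

lemma clarke_cone_eventually_good:
  assumes "v \<in> clarke_cone type_space C x" "\<epsilon> > 0"
  obtains j where "\<forall>\<^sub>F n in sequentially. clarke_good C x v (inverse (Suc j)) (inverse (Suc n)) \<epsilon>"
proof -
  obtain \<delta> \<kappa> where "\<delta> > 0" "\<kappa> > 0" and
    *: "\<forall>y \<in> C \<inter> cball x \<delta>. \<forall>\<eta>\<in>{0..\<kappa>}. C \<inter> (\<lambda>w. y + \<eta> *\<^sub>R w) ` cball v \<epsilon> \<noteq> {}"
    using assms(1)[unfolded clarke_cone_type_space mem_Collect_eq, rule_format, OF assms(2)]
    by (elim exE conjE) (rule that)
  obtain j where j: "inverse (real (Suc j)) < \<delta>" using reals_Archimedean \<open>\<delta> > 0\<close> by blast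
  have "\<forall>\<^sub>F n in sequentially. inverse (real (Suc n)) < \<kappa>"
    using order_tendstoD(2)[OF LIMSEQ_inverse_real_of_nat \<open>\<kappa> > 0\<close>] .
  then have "\<forall>\<^sub>F n in sequentially. clarke_good C x v (inverse (Suc j)) (inverse (Suc n)) \<epsilon>"
  proof eventually_elim
    case (elim n)
    define h where "h = inverse (real (Suc n))"
    have h: "h > 0" "h \<in> {0..\<kappa>}" using elim by (auto simp: h_def)
    have "infdist (y + h *\<^sub>R v) C \<le> h * \<epsilon>" if "y \<in> C \<inter> ball x (inverse (Suc j))" for y
    proof -
      have "y \<in> C \<inter> cball x \<delta>" using that j by auto
      from *[rule_format, OF this h(2)] obtain w where w: "w \<in> cball v \<epsilon>" "y + h *\<^sub>R w \<in> C" by auto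
      have "infdist (y + h *\<^sub>R v) C \<le> dist (y + h *\<^sub>R v) (y + h *\<^sub>R w)"
        by (intro infdist_le w)
      also have "\<dots> = h * norm (v - w)"
        using h by (simp add: dist_norm flip: scaleR_diff_right)
      also have "\<dots> \<le> h * \<epsilon>"
        using w(1) h by (intro mult_left_mono) (auto simp: dist_norm)
      finally show ?thesis .
    qed
    then show ?case by (auto simp: clarke_good_def h_def)
  qed
  then show ?thesis by (rule that)
qed

lemma clarke_coneI_frequently_good:
  assumes "\<And>m. \<exists>j. \<exists>\<^sub>F n in sequentially.
      clarke_good C x v (inverse (Suc j)) (inverse (Suc n)) (inverse (Suc m))"
  shows "v \<in> clarke_cone type_space C x"
  unfolding clarke_cone_type_space mem_Collect_eq
proof (intro allI impI)
  fix \<epsilon> :: real assume "\<epsilon> > 0"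
  then obtain m where "inverse (real (Suc m)) < \<epsilon> / 4" using reals_Archimedean[of "\<epsilon> / 4"] by auto
  moreover define e where "e = inverse (real (Suc m))"
  ultimately have e: "e > 0" "4 * e < \<epsilon>" by auto
  obtain j where j: "\<exists>\<^sub>F n in sequentially.
      clarke_good C x v (inverse (Suc j)) (inverse (Suc n)) e"
    using assms[of m] e_def by auto
  define D where "D = 1 + norm v + 2 * e"
  have "D > 0" unfolding D_def using e by (smt (verit) norm_ge_zero)
  define s where "s = inverse (Suc j) / D"
  have s: "s > 0" "s * (1 + norm v + 2 * e) \<le> inverse (Suc j)"
    using \<open>D > 0\<close> unfolding s_def D_def[symmetric] by auto
  have "C \<inter> (\<lambda>w. y + \<eta> *\<^sub>R w) ` cball v \<epsilon> \<noteq> {}"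
    if y: "y \<in> C \<inter> cball x (s / 2)" and \<eta>: "\<eta> \<in> {0..s}" for y \<eta>
  proof (cases "\<eta> = 0")
    case True
    have "y = y + \<eta> *\<^sub>R v" "v \<in> cball v \<epsilon>" using True \<open>\<epsilon> > 0\<close> by simp_all
    then show ?thesis using y by blast
  next
    case False
    then have "\<eta> > 0" using \<eta> by auto
    have "infdist (y + \<eta> *\<^sub>R v) C \<le> 3 * \<eta> * e"
      using y \<eta> s \<open>\<eta> > 0\<close> by (intro clarke_good_multistep[OF j \<open>e > 0\<close> _ _ _ _ s(2)]) auto
    also have "\<dots> < \<eta> * \<epsilon>"
      using mult_strict_left_mono[of "3 * e" \<epsilon> \<eta>] e \<open>\<eta> > 0\<close> by (simp add: mult_ac)
    finally obtain c where c: "c \<in> C" "dist (y + \<eta> *\<^sub>R v) c < \<eta> * \<epsilon>"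
      using y infdist_lessE by blast
    define w where "w = (c - y) /\<^sub>R \<eta>"
    have cw: "c = y + \<eta> *\<^sub>R w" using \<open>\<eta> > 0\<close> by (simp add: w_def)
    have "\<eta> * dist v w < \<eta> * \<epsilon>"
      using c(2) \<open>\<eta> > 0\<close> unfolding cw by (simp add: dist_norm flip: scaleR_diff_right)
    then have "w \<in> cball v \<epsilon>" using \<open>\<eta> > 0\<close> by auto
    then show ?thesis using c cw by blast
  qed
  then show "\<exists>\<delta>>0. \<exists>\<kappa>>0. \<forall>y\<in>C \<inter> cball x \<delta>. \<forall>\<eta>\<in>{0..\<kappa>}.
      C \<inter> (\<lambda>w. y + \<eta> *\<^sub>R w) ` cball v \<epsilon> \<noteq> {}"
    using s by (intro exI[of _ "s / 2"] exI[of _ s]) auto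
qed

subsection \<open>Measurable selections\<close>

lemma obtain_dense_sequence:
  obtains z :: "nat \<Rightarrow> 'z::{metric_space, second_countable_topology}"
  where "\<And>y e. e > 0 \<Longrightarrow> \<exists>k. dist y (z k) < e"
proof -
  obtain D :: "'z set" where D: "countable D" "\<And>X. open X \<Longrightarrow> X \<noteq> {} \<Longrightarrow> \<exists>d\<in>D. d \<in> X"
    by (rule countable_dense_setE) blast
  have "D \<noteq> {}" using D(2)[of UNIV] by auto
  have "\<exists>k. dist y (from_nat_into D k) < e" if "e > 0" for y e
  proof -
    have "\<exists>d\<in>D. d \<in> ball y e" using D(2)[of "ball y e"] that by auto
    then show ?thesis using D(1) \<open>D \<noteq> {}\<close>
      by (metis from_nat_into_surj mem_ball)
  qed
  then show ?thesis by (rule that)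
qed

lemma borel_measurable_infdist_multifunction:
  fixes S :: "'t \<Rightarrow> 'z::{metric_space, second_countable_topology} set"
  assumes S: "measurable_multifunction M S" and f [measurable]: "f \<in> borel_measurable M"
  shows "(\<lambda>t. infdist (f t) (S t)) \<in> borel_measurable M"
proof -
  have ne: "S t \<noteq> {}" if "t \<in> space M" for t
    using S that by (auto simp: measurable_multifunction_def)
  have [measurable]: "(\<lambda>t. infdist z (S t)) \<in> borel_measurable M" for z
  proof (rule borel_measurableI_less)
    fix a
    have "infdist z (S t) < a \<longleftrightarrow> S t \<inter> ball z a \<noteq> {}" if "t \<in> space M" for t
    proof
      assume "infdist z (S t) < a"
      then show "S t \<inter> ball z a \<noteq> {}" using ne[OF that] by (auto elim!: infdist_lessE)
    next
      assume "S t \<inter> ball z a \<noteq> {}"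
      then obtain y where "y \<in> S t" "dist z y < a" by auto
      then show "infdist z (S t) < a" using infdist_le[of y "S t" z] by linarith
    qed
    then have "{t \<in> space M. infdist z (S t) < a} = {t \<in> space M. S t \<inter> ball z a \<noteq> {}}"
      by blast
    also have "\<dots> \<in> sets M" using S by (auto simp: measurable_multifunction_def)
    finally show "{t \<in> space M. infdist z (S t) < a} \<in> sets M" .
  qed
  obtain z :: "nat \<Rightarrow> 'z" where z: "\<And>y e. e > 0 \<Longrightarrow> \<exists>k. dist y (z k) < e"
    by (rule obtain_dense_sequence) blast
  show ?thesis
  proof (rule borel_measurableI_less)
    fix a
    have "infdist (f t) (S t) < a \<longleftrightarrow>
      (\<exists>k j. dist (f t) (z k) < inverse (Suc j) \<and> infdist (z k) (S t) < a - inverse (Suc j))" for t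
    proof
      assume "infdist (f t) (S t) < a"
      then obtain j where "inverse (real (Suc j)) < (a - infdist (f t) (S t)) / 2"
        using reals_Archimedean[of "(a - infdist (f t) (S t)) / 2"] by auto
      moreover define q where "q = inverse (real (Suc j))"
      ultimately have q: "0 < q" "q < (a - infdist (f t) (S t)) / 2" by auto
      obtain k where k: "dist (f t) (z k) < q" using z q by blast
      then have "infdist (z k) (S t) < a - q"
        using q infdist_triangle[of "z k" "S t" "f t"] by (simp add: dist_commute)
      then show "\<exists>k j. dist (f t) (z k) < inverse (Suc j) \<and> infdist (z k) (S t) < a - inverse (Suc j)"
        using k unfolding q_def by blast
    next
      assume "\<exists>k j. dist (f t) (z k) < inverse (Suc j) \<and> infdist (z k) (S t) < a - inverse (Suc j)"
      then obtain k j where "dist (f t) (z k) < inverse (Suc j)"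
        "infdist (z k) (S t) < a - inverse (Suc j)" by blast
      then show "infdist (f t) (S t) < a" using infdist_triangle[of "f t" "S t" "z k"] by linarith
    qed
    then show "{t \<in> space M. infdist (f t) (S t) < a} \<in> sets M" by simp
  qed
qed

text \<open>Kuratowski--Ryll-Nardzewski iteration, started at \<open>f\<close> so that the selection stays near \<open>f\<close>.\<close>

lemma measurable_selection_near:
  fixes S :: "'t \<Rightarrow> 'z::{banach, second_countable_topology} set"
  assumes S: "measurable_multifunction M S"
    and [measurable]: "f \<in> borel_measurable M" "\<rho> \<in> borel_measurable M"
  obtains w where "w \<in> borel_measurable M"
    "\<And>t. t \<in> space M \<Longrightarrow> infdist (f t) (S t) < \<rho> t \<Longrightarrow> w t \<in> S t \<and> dist (f t) (w t) \<le> 2 * \<rho> t"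
proof -
  note [measurable] = borel_measurable_infdist_multifunction[OF S]
  obtain z :: "nat \<Rightarrow> 'z" where z: "\<And>y e. e > 0 \<Longrightarrow> \<exists>k. dist y (z k) < e"
    by (rule obtain_dense_sequence) blast
  define F where "F = rec_nat f (\<lambda>n g t. z (LEAST k. infdist (z k) (S t) < \<rho> t / 2 ^ Suc n \<and>
    dist (z k) (g t) < \<rho> t / 2 ^ n))"
  have F0: "F 0 = f" by (simp add: F_def)
  have FS: "F (Suc n) t = z (LEAST k. infdist (z k) (S t) < \<rho> t / 2 ^ Suc n \<and>
    dist (z k) (F n t) < \<rho> t / 2 ^ n)" for n t
    by (simp add: F_def)
  have [measurable]: "F n \<in> borel_measurable M" for n
  proof (induction n)
    case 0
    then show ?case by (simp add: F0)
  next
    case (Suc n)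
    note [measurable] = Suc
    have "F (Suc n) = (\<lambda>t. z (LEAST k. infdist (z k) (S t) < \<rho> t / 2 ^ Suc n \<and>
      dist (z k) (F n t) < \<rho> t / 2 ^ n))"
      using FS by blast
    also have "\<dots> \<in> borel_measurable M" by measurable
    finally show ?case .
  qed
  have lim: "lim (\<lambda>n. F n t) \<in> S t \<and> dist (f t) (lim (\<lambda>n. F n t)) \<le> 2 * \<rho> t"
    if t: "t \<in> space M" and near: "infdist (f t) (S t) < \<rho> t" for t
  proof -
    have ne: "S t \<noteq> {}" and cl: "closed (S t)"
      using S t by (auto simp: measurable_multifunction_def)
    have pos: "\<rho> t > 0" using near infdist_nonneg[of "f t" "S t"] by linarith
    have step: "infdist (F (Suc n) t) (S t) < \<rho> t / 2 ^ Suc n \<and> dist (F (Suc n) t) (F n t) < \<rho> t / 2 ^ n"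
      if *: "infdist (F n t) (S t) < \<rho> t / 2 ^ n" for n
    proof -
      obtain y where y: "y \<in> S t" "dist (F n t) y < \<rho> t / 2 ^ n"
        using infdist_lessE[OF * ne] by blast
      define e where "e = min (\<rho> t / 2 ^ Suc n) (\<rho> t / 2 ^ n - dist (F n t) y)"
      have "e > 0" using pos y(2) by (auto simp: e_def)
      then obtain k where k: "dist y (z k) < e" using z by blast
      have "infdist (z k) (S t) < \<rho> t / 2 ^ Suc n"
        using k infdist_le[OF y(1), of "z k"] by (simp add: e_def dist_commute)
      moreover have "dist (z k) (F n t) < \<rho> t / 2 ^ n"
        using k dist_triangle[of "z k" "F n t" y] by (simp add: e_def dist_commute)
      ultimately show ?thesis
        unfolding FS by (rule LeastI2[where a=k, OF conjI])
    qed
    have inf: "infdist (F n t) (S t) < \<rho> t / 2 ^ n" for n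
      by (induction n) (use near step F0 in auto)
    have d: "norm (F (Suc n) t - F n t) \<le> \<rho> t * (1 / 2) ^ n" for n
      using step[OF inf, of n] by (simp add: dist_norm power_one_over)
    have sg: "(\<lambda>n. \<rho> t * (1 / 2) ^ n) sums (\<rho> t * (1 / (1 - 1 / 2)))"
      by (intro sums_mult geometric_sums) simp
    have sm: "summable (\<lambda>n. F (Suc n) t - F n t)"
      using d by (intro summable_comparison_test[OF _ sums_summable[OF sg]]) auto
    define l where "l = f t + (\<Sum>n. F (Suc n) t - F n t)"
    have "(\<lambda>n. f t + (\<Sum>k<n. F (Suc k) t - F k t)) \<longlonglongrightarrow> l"
      unfolding l_def by (intro tendsto_intros summable_LIMSEQ sm)
    moreover have "f t + (\<Sum>k<n. F (Suc k) t - F k t) = F n t" for n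
      using sum_lessThan_telescope[of "\<lambda>k. F k t" n] by (simp add: F0)
    ultimately have l: "(\<lambda>n. F n t) \<longlonglongrightarrow> l" by simp
    have "norm (\<Sum>n. F (Suc n) t - F n t) \<le> (\<Sum>n. \<rho> t * (1 / 2) ^ n)"
      by (rule norm_suminf_le[OF d sums_summable[OF sg]])
    then have "dist (f t) l \<le> 2 * \<rho> t"
      using sums_unique[OF sg] by (simp add: l_def dist_norm)
    moreover have "infdist l (S t) = 0"
    proof (rule antisym[OF _ infdist_nonneg])
      have "(\<lambda>n. \<rho> t * (1 / 2) ^ n) \<longlonglongrightarrow> 0"
        using sums_summable[OF sg] by (rule summable_LIMSEQ_zero)
      then show "infdist l (S t) \<le> 0"
        using inf by (intro LIMSEQ_le[OF tendsto_infdist[OF l]])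
          (auto simp: power_one_over intro!: exI[of _ 0] less_imp_le)
    qed
    then have "l \<in> S t" using in_closed_iff_infdist_zero[OF cl ne] by simp
    ultimately show ?thesis using limI[OF l] by simp
  qed
  show ?thesis
    by (rule that[of "\<lambda>t. lim (\<lambda>n. F n t)"]) (use lim in auto)
qed

lemma not_clarke_good_iff:
  assumes z: "\<And>y e. e > 0 \<Longrightarrow> \<exists>k. dist y (z k) < e" and "C \<noteq> {}"
  shows "\<not> clarke_good C x v r \<eta> \<epsilon> \<longleftrightarrow> (\<exists>k j. infdist (z k) C < inverse (Suc j) \<and>
    dist (z k) x + 2 * inverse (Suc j) < r \<and>
    infdist (z k + \<eta> *\<^sub>R v) C > \<eta> * \<epsilon> + 2 * inverse (Suc j))" (is "?L \<longleftrightarrow> ?R")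
proof
  assume ?L
  then obtain y where y: "y \<in> C" "dist x y < r" "infdist (y + \<eta> *\<^sub>R v) C > \<eta> * \<epsilon>"
    by (auto simp: clarke_good_def not_le)
  define e where "e = min (r - dist x y) (infdist (y + \<eta> *\<^sub>R v) C - \<eta> * \<epsilon>) / 3"
  have "e > 0" using y by (simp add: e_def)
  then obtain j where "inverse (real (Suc j)) < e" using reals_Archimedean by blast
  moreover define q where "q = inverse (real (Suc j))"
  ultimately have q: "q > 0" "q < e" by auto
  then have q': "3 * q < r - dist x y" "3 * q < infdist (y + \<eta> *\<^sub>R v) C - \<eta> * \<epsilon>"
    unfolding e_def by auto
  obtain k where k: "dist y (z k) < q" using z q by blast
  have "infdist (z k) C < q" using k infdist_le[OF y(1), of "z k"] by (simp add: dist_commute)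
  moreover have "dist (z k) x + 2 * q < r"
    using k q' dist_triangle[of "z k" x y] by (simp add: dist_commute)
  moreover have "infdist (z k + \<eta> *\<^sub>R v) C > \<eta> * \<epsilon> + 2 * q"
    using k q' infdist_triangle[of "y + \<eta> *\<^sub>R v" C "z k + \<eta> *\<^sub>R v"] by simp
  ultimately show ?R unfolding q_def by blast
next
  assume ?R
  then obtain k q where *: "infdist (z k) C < q" "dist (z k) x + 2 * q < r"
    "infdist (z k + \<eta> *\<^sub>R v) C > \<eta> * \<epsilon> + 2 * q" by blast
  obtain y where y: "y \<in> C" "dist (z k) y < q" using infdist_lessE[OF *(1) \<open>C \<noteq> {}\<close>] by blast
  have "0 < q" using *(1) infdist_nonneg[of "z k" C] by linarith
  then have "dist x y < r" using y * dist_triangle[of y x "z k"] by (simp add: dist_commute)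
  moreover have "infdist (y + \<eta> *\<^sub>R v) C > \<eta> * \<epsilon>"
    using * y \<open>0 < q\<close> infdist_triangle[of "z k + \<eta> *\<^sub>R v" C "y + \<eta> *\<^sub>R v"] by simp
  ultimately show ?L using y(1) by (force simp: clarke_good_def)
qed

lemma clarke_good_measurable_and_selection:
  fixes S :: "'t \<Rightarrow> 'z::{banach, second_countable_topology} set"
  assumes S: "measurable_multifunction M S"
    and [measurable]: "x \<in> borel_measurable M" "v \<in> borel_measurable M" "e \<in> borel_measurable M"
  shows measurable_clarke_good: "Measurable.pred M (\<lambda>t. clarke_good (S t) (x t) (v t) r \<eta> (e t))"
    and measurable_selection_not_good: "\<exists>y\<in>borel_measurable M. \<forall>t\<in>space M.
      \<not> clarke_good (S t) (x t) (v t) r \<eta> (e t) \<longrightarrow> y t \<in> S t \<and> dist (x t) (y t) < r \<and>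
        infdist (y t + \<eta> *\<^sub>R v t) (S t) > \<eta> * e t"
proof -
  note [measurable] = borel_measurable_infdist_multifunction[OF S]
  have ne: "S t \<noteq> {}" if "t \<in> space M" for t
    using S that by (auto simp: measurable_multifunction_def)
  obtain z :: "nat \<Rightarrow> 'z" where z: "\<And>y e. e > 0 \<Longrightarrow> \<exists>k. dist y (z k) < e"
    by (rule obtain_dense_sequence) blast
  define P where "P = (\<lambda>k j t. infdist (z k) (S t) < inverse (Suc j) \<and>
    dist (z k) (x t) + 2 * inverse (Suc j) < r \<and>
    infdist (z k + \<eta> *\<^sub>R v t) (S t) > \<eta> * e t + 2 * inverse (Suc j))"
  have P: "\<not> clarke_good (S t) (x t) (v t) r \<eta> (e t) \<longleftrightarrow> (\<exists>k j. P k j t)" if "t \<in> space M" for t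
    unfolding P_def by (rule not_clarke_good_iff[OF z ne[OF that]])
  have [measurable]: "Measurable.pred M (P k j)" for k j
    unfolding P_def by measurable
  have "Measurable.pred M (\<lambda>t. \<not> (\<exists>k j. P k j t))" by measurable
  then show "Measurable.pred M (\<lambda>t. clarke_good (S t) (x t) (v t) r \<eta> (e t))"
    by (rule measurable_cong[THEN iffD1, rotated]) (use P in blast)
  define i where "i t = (LEAST i. P (fst (prod_decode i)) (snd (prod_decode i)) t)" for t
  have [measurable]: "i \<in> measurable M (count_space UNIV)" unfolding i_def by measurable
  define f where "f t = z (fst (prod_decode (i t)))" for t
  define \<rho> where "\<rho> t = inverse (real (Suc (snd (prod_decode (i t)))))" for t
  have [measurable]: "f \<in> borel_measurable M" "\<rho> \<in> borel_measurable M"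
    unfolding f_def \<rho>_def by measurable
  obtain w where w: "w \<in> borel_measurable M" "\<And>t. t \<in> space M \<Longrightarrow>
    infdist (f t) (S t) < \<rho> t \<Longrightarrow> w t \<in> S t \<and> dist (f t) (w t) \<le> 2 * \<rho> t"
    using measurable_selection_near[OF S, of f \<rho>] by auto
  have "w t \<in> S t \<and> dist (x t) (w t) < r \<and> infdist (w t + \<eta> *\<^sub>R v t) (S t) > \<eta> * e t"
    if t: "t \<in> space M" and bad: "\<not> clarke_good (S t) (x t) (v t) r \<eta> (e t)" for t
  proof -
    obtain k j where "P k j t" using P[OF t] bad by blast
    then have "P (fst (prod_decode (prod_encode (k, j)))) (snd (prod_decode (prod_encode (k, j)))) t"
      by simp
    then have "P (fst (prod_decode (i t))) (snd (prod_decode (i t))) t"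
      unfolding i_def by (rule LeastI)
    then have *: "infdist (f t) (S t) < \<rho> t" "dist (f t) (x t) + 2 * \<rho> t < r"
      "infdist (f t + \<eta> *\<^sub>R v t) (S t) > \<eta> * e t + 2 * \<rho> t"
      unfolding P_def f_def \<rho>_def by auto
    have wt: "w t \<in> S t" "dist (f t) (w t) \<le> 2 * \<rho> t" using w(2)[OF t *(1)] by auto
    have "dist (x t) (w t) < r"
      using wt * dist_triangle[of "x t" "w t" "f t"] by (simp add: dist_commute)
    moreover have "infdist (w t + \<eta> *\<^sub>R v t) (S t) > \<eta> * e t"
      using wt * infdist_triangle[of "f t + \<eta> *\<^sub>R v t" "S t" "w t + \<eta> *\<^sub>R v t"] by simp
    ultimately show ?thesis using wt by blast
  qed
  then show "\<exists>y\<in>borel_measurable M. \<forall>t\<in>space M.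
      \<not> clarke_good (S t) (x t) (v t) r \<eta> (e t) \<longrightarrow> y t \<in> S t \<and> dist (x t) (y t) < r \<and>
        infdist (y t + \<eta> *\<^sub>R v t) (S t) > \<eta> * e t"
    using w(1) by blast
qed

subsection \<open>Lebesgue--Bochner spaces\<close>

lemma norm_add_powr_le:
  fixes a b :: "'a::real_normed_vector"
  assumes "0 \<le> p"
  shows "norm (a + b) powr p \<le> 2 powr p * (norm a powr p + norm b powr p)"
proof -
  define m where "m = max (norm a) (norm b)"
  have m: "0 \<le> m" "norm (a + b) \<le> 2 * m"
    unfolding m_def using norm_triangle_ineq[of a b] by (auto simp: max_def)
  have "norm (a + b) powr p \<le> (2 * m) powr p"
    using m assms by (intro powr_mono2) auto
  also have "\<dots> = 2 powr p * m powr p" using m by (simp add: powr_mult)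
  also have "m powr p \<le> norm a powr p + norm b powr p"
    by (auto simp: m_def max_def)
  finally show ?thesis by simp
qed

lemma Lp_fun_add:
  assumes "f \<in> Lp_fun p M" "g \<in> Lp_fun p M" "0 \<le> p"
  shows "(\<lambda>t. f t + g t) \<in> Lp_fun p M"
proof -
  have [measurable]: "f \<in> borel_measurable M" "g \<in> borel_measurable M"
    using assms by (auto simp: Lp_fun_def)
  have "integrable M (\<lambda>t. 2 powr p * (norm (f t) powr p + norm (g t) powr p))"
    using assms by (auto simp: Lp_fun_def)
  then have "integrable M (\<lambda>t. norm (f t + g t) powr p)"
    by (rule Bochner_Integration.integrable_bound)
      (use norm_add_powr_le[OF assms(3)] in \<open>auto intro!: AE_I2\<close>)
  then show ?thesis by (simp add: Lp_fun_def)
qed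

lemma Lp_fun_scaleR:
  assumes "f \<in> Lp_fun p M"
  shows "(\<lambda>t. c *\<^sub>R f t) \<in> Lp_fun p M"
  using assms by (auto simp: Lp_fun_def powr_mult)

lemma Lp_fun_diff:
  assumes "f \<in> Lp_fun p M" "g \<in> Lp_fun p M" "0 \<le> p"
  shows "(\<lambda>t. f t - g t) \<in> Lp_fun p M"
  using Lp_fun_add[OF assms(1) Lp_fun_scaleR[OF assms(2), of "-1"] assms(3)] by simp

lemma Lp_eqI:
  assumes "u \<in> vectors (Lp p M)" "w \<in> vectors (Lp p M)" "AE t in M. rep u t = rep w t"
  shows "u = w"
proof -
  have "(rep u, rep w) \<in> ae_eq p M" using assms rep_in(2) by (auto simp: ae_eq_def)
  then have "Lp_class p M (rep u) = Lp_class p M (rep w)"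
    unfolding Lp_class_def by (rule equiv_class_eq[OF equiv_ae_eq])
  then show ?thesis using rep_in(3) assms(1,2) by metis
qed

lemma rep_vadd:
  assumes "u \<in> vectors (Lp p M)" "w \<in> vectors (Lp p M)" "0 \<le> p"
  shows "vadd (Lp p M) u w \<in> vectors (Lp p M)"
    and "AE t in M. rep (vadd (Lp p M) u w) t = rep u t + rep w t"
  using rep_Lp_class[OF Lp_fun_add[OF rep_in(2)[OF assms(1)] rep_in(2)[OF assms(2)] assms(3)]]
  by (simp_all add: Lp_def)

lemma rep_vscale:
  assumes "u \<in> vectors (Lp p M)"
  shows "vscale (Lp p M) c u \<in> vectors (Lp p M)"
    and "AE t in M. rep (vscale (Lp p M) c u) t = c *\<^sub>R rep u t"
  using rep_Lp_class[OF Lp_fun_scaleR[OF rep_in(2)[OF assms]]]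
  by (simp_all add: Lp_def)

lemma rep_measurable:
  assumes "u \<in> vectors (Lp p M)"
  shows "rep u \<in> borel_measurable M"
  using rep_in(2)[OF assms] by (simp add: Lp_fun_def)

lemma vnorm_Lp_le_1_iff:
  assumes "0 < p"
  shows "vnorm (Lp p M) u \<le> 1 \<longleftrightarrow> (\<integral>t. norm (rep u t) powr p \<partial>M) \<le> 1"
proof -
  define I where "I = (\<integral>t. norm (rep u t) powr p \<partial>M)"
  have "I \<ge> 0" by (simp add: I_def)
  have "I powr (1 / p) \<le> 1 \<longleftrightarrow> I \<le> 1"
    using powr_mono2[of "1 / p" I 1] powr_less_mono2[of "1 / p" 1 I] assms \<open>I \<ge> 0\<close>
    by (cases "I \<le> 1") (auto simp: not_le)
  then show ?thesis by (simp add: Lp_def I_def)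
qed

lemma mem_shifted_cball_Lp:
  assumes a: "a \<in> vectors (Lp p M)" and "0 < r" "0 < p"
  shows "y \<in> shifted_cball (Lp p M) a r \<longleftrightarrow>
    y \<in> vectors (Lp p M) \<and> (\<integral>t. norm (rep y t - rep a t) powr p \<partial>M) \<le> r powr p"
proof
  assume "y \<in> shifted_cball (Lp p M) a r"
  then obtain b where b: "b \<in> vectors (Lp p M)" "(\<integral>t. norm (rep b t) powr p \<partial>M) \<le> 1"
    and y: "y = vadd (Lp p M) a (vscale (Lp p M) r b)"
    using vnorm_Lp_le_1_iff[OF \<open>0 < p\<close>] by (auto simp: shifted_cball_def unit_cball_def)
  note sb = rep_vscale[OF b(1), of r]
  have yv: "y \<in> vectors (Lp p M)" and "AE t in M. rep y t = rep a t + rep (vscale (Lp p M) r b) t"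
    unfolding y using \<open>0 < p\<close> by (auto intro!: rep_vadd a sb)
  with sb(2) have "AE t in M. rep y t - rep a t = r *\<^sub>R rep b t" by auto
  note [measurable] = rep_measurable[OF a] rep_measurable[OF b(1)] rep_measurable[OF yv]
  have "(\<integral>t. norm (rep y t - rep a t) powr p \<partial>M) = (\<integral>t. r powr p * norm (rep b t) powr p \<partial>M)"
    by (rule integral_cong_AE)
      (use \<open>AE t in M. rep y t - rep a t = r *\<^sub>R rep b t\<close> \<open>0 < r\<close> in
        \<open>auto elim!: eventually_mono simp: powr_mult\<close>)
  also have "\<dots> = r powr p * (\<integral>t. norm (rep b t) powr p \<partial>M)" by simp
  also have "\<dots> \<le> r powr p" using b(2) by (simp add: mult_left_le)
  finally show "y \<in> vectors (Lp p M) \<and> (\<integral>t. norm (rep y t - rep a t) powr p \<partial>M) \<le> r powr p"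
    using yv by simp
next
  assume y: "y \<in> vectors (Lp p M) \<and> (\<integral>t. norm (rep y t - rep a t) powr p \<partial>M) \<le> r powr p"
  define b where "b = Lp_class p M (\<lambda>t. (1 / r) *\<^sub>R (rep y t - rep a t))"
  have "(\<lambda>t. (1 / r) *\<^sub>R (rep y t - rep a t)) \<in> Lp_fun p M"
    using rep_in(2) a y \<open>0 < p\<close> by (intro Lp_fun_scaleR Lp_fun_diff) auto
  note b = rep_Lp_class[OF this, folded b_def]
  note [measurable] = rep_measurable[OF a] rep_measurable[OF b(1)] rep_measurable[OF conjunct1[OF y]]
  have "(\<integral>t. norm (rep b t) powr p \<partial>M) =
      (\<integral>t. (1 / r) powr p * norm (rep y t - rep a t) powr p \<partial>M)"
    by (rule integral_cong_AE)
      (use b(2) \<open>0 < r\<close> in \<open>auto elim!: eventually_mono simp: powr_mult powr_divide\<close>)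
  also have "\<dots> = (1 / r) powr p * (\<integral>t. norm (rep y t - rep a t) powr p \<partial>M)" by simp
  also have "\<dots> \<le> (1 / r) powr p * r powr p" using y by (intro mult_left_mono) auto
  also have "\<dots> = 1" using \<open>0 < r\<close> by (simp flip: powr_mult)
  finally have "b \<in> unit_cball (Lp p M)"
    using b(1) vnorm_Lp_le_1_iff[OF \<open>0 < p\<close>] by (auto simp: unit_cball_def)
  moreover have "y = vadd (Lp p M) a (vscale (Lp p M) r b)"
  proof (rule Lp_eqI)
    have "AE t in M. rep (vadd (Lp p M) a (vscale (Lp p M) r b)) t
        = rep a t + rep (vscale (Lp p M) r b) t"
      using a b rep_vscale \<open>0 < p\<close> by (intro rep_vadd) auto
    with rep_vscale(2)[OF b(1), of r] b(2)
    show "AE t in M. rep y t = rep (vadd (Lp p M) a (vscale (Lp p M) r b)) t"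
      by eventually_elim (use \<open>0 < r\<close> in simp)
  qed (use y a b rep_vscale \<open>0 < p\<close> in \<open>auto intro!: rep_vadd\<close>)
  ultimately show "y \<in> shifted_cball (Lp p M) a r" by (auto simp: shifted_cball_def)
qed

lemma clarke_cone_Lp_iff:
  assumes C: "C \<subseteq> vectors (Lp p M)" and x: "x \<in> vectors (Lp p M)" and "0 < p"
  shows "v \<in> clarke_cone (Lp p M) C x \<longleftrightarrow> v \<in> vectors (Lp p M) \<and>
    (\<forall>\<epsilon>>0. \<exists>\<delta>>0. \<exists>\<kappa>>0. \<forall>y\<in>C. (\<integral>t. norm (rep y t - rep x t) powr p \<partial>M) \<le> \<delta> powr p \<longrightarrow>
      (\<forall>\<eta>\<in>{0<..\<kappa>}. \<exists>c\<in>C.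
        (\<integral>t. norm (rep c t - rep y t - \<eta> *\<^sub>R rep v t) powr p \<partial>M) \<le> (\<eta> * \<epsilon>) powr p))"
proof -
  have step: "C \<inter> (\<lambda>w. vadd (Lp p M) y (vscale (Lp p M) \<eta> w)) ` shifted_cball (Lp p M) v \<epsilon> \<noteq> {}
      \<longleftrightarrow> \<eta> = 0 \<or> (\<exists>c\<in>C.
        (\<integral>t. norm (rep c t - rep y t - \<eta> *\<^sub>R rep v t) powr p \<partial>M) \<le> (\<eta> * \<epsilon>) powr p)"
    (is "?L \<longleftrightarrow> ?R")
    if v: "v \<in> vectors (Lp p M)" and "\<epsilon> > 0" and y: "y \<in> C" and "\<eta> \<ge> 0" for v y \<eta> \<epsilon>
  proof -
    have yv: "y \<in> vectors (Lp p M)" using y C by blast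
    note [measurable] = rep_measurable[OF v] rep_measurable[OF yv]
    have comb: "vadd (Lp p M) y (vscale (Lp p M) \<eta> w) \<in> vectors (Lp p M)"
      "AE t in M. rep (vadd (Lp p M) y (vscale (Lp p M) \<eta> w)) t = rep y t + \<eta> *\<^sub>R rep w t"
      if w: "w \<in> vectors (Lp p M)" for w
    proof -
      show "vadd (Lp p M) y (vscale (Lp p M) \<eta> w) \<in> vectors (Lp p M)"
        using rep_vadd(1)[OF yv rep_vscale(1)[OF w]] \<open>0 < p\<close> by simp
      have "AE t in M. rep (vadd (Lp p M) y (vscale (Lp p M) \<eta> w)) t
          = rep y t + rep (vscale (Lp p M) \<eta> w) t"
        using rep_vadd(2)[OF yv rep_vscale(1)[OF w]] \<open>0 < p\<close> by simp
      with rep_vscale(2)[OF w, of \<eta>]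
      show "AE t in M. rep (vadd (Lp p M) y (vscale (Lp p M) \<eta> w)) t = rep y t + \<eta> *\<^sub>R rep w t"
        by eventually_elim simp
    qed
    have scale: "(\<integral>t. norm (rep c t - rep y t - \<eta> *\<^sub>R rep v t) powr p \<partial>M) \<le> (\<eta> * \<epsilon>) powr p \<longleftrightarrow>
        (\<integral>t. norm (rep w t - rep v t) powr p \<partial>M) \<le> \<epsilon> powr p"
      if "\<eta> > 0" and w: "w \<in> vectors (Lp p M)" and c: "c \<in> vectors (Lp p M)"
        and cw: "AE t in M. rep c t = rep y t + \<eta> *\<^sub>R rep w t" for c w
    proof -
      note [measurable] = rep_measurable[OF w] rep_measurable[OF c]
      have "AE t in M. norm (rep c t - rep y t - \<eta> *\<^sub>R rep v t) powr p =
          \<eta> powr p * norm (rep w t - rep v t) powr p"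
        using cw
      proof eventually_elim
        case (elim t)
        have "norm (rep c t - rep y t - \<eta> *\<^sub>R rep v t) = \<eta> * norm (rep w t - rep v t)"
          unfolding elim using \<open>\<eta> > 0\<close> by (simp flip: scaleR_diff_right)
        then show ?case using \<open>\<eta> > 0\<close> by (simp add: powr_mult)
      qed
      then have "(\<integral>t. norm (rep c t - rep y t - \<eta> *\<^sub>R rep v t) powr p \<partial>M) =
          (\<integral>t. \<eta> powr p * norm (rep w t - rep v t) powr p \<partial>M)"
        by (intro integral_cong_AE) auto
      then show ?thesis using \<open>\<eta> > 0\<close> \<open>\<epsilon> > 0\<close> by (simp add: powr_mult)
    qed
    show ?thesis
    proof
      assume ?L
      then obtain w where w: "w \<in> shifted_cball (Lp p M) v \<epsilon>"
        "vadd (Lp p M) y (vscale (Lp p M) \<eta> w) \<in> C" by blast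
      then have w': "w \<in> vectors (Lp p M)" "(\<integral>t. norm (rep w t - rep v t) powr p \<partial>M) \<le> \<epsilon> powr p"
        using mem_shifted_cball_Lp[OF v \<open>\<epsilon> > 0\<close> \<open>0 < p\<close>] by auto
      show ?R
        using scale[OF _ w'(1) comb[OF w'(1)]] w'(2) w(2) \<open>\<eta> \<ge> 0\<close> by fastforce
    next
      assume ?R
      then consider "\<eta> = 0" | c where "\<eta> > 0" "c \<in> C"
        "(\<integral>t. norm (rep c t - rep y t - \<eta> *\<^sub>R rep v t) powr p \<partial>M) \<le> (\<eta> * \<epsilon>) powr p"
        using \<open>\<eta> \<ge> 0\<close> by force
      then show ?L
      proof cases
        case 1
        have "v \<in> shifted_cball (Lp p M) v \<epsilon>"
          using mem_shifted_cball_Lp[OF v \<open>\<epsilon> > 0\<close> \<open>0 < p\<close>] v by simp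
        moreover have "vadd (Lp p M) y (vscale (Lp p M) \<eta> v) = y"
          by (rule Lp_eqI[OF comb(1)[OF v] yv]) (use comb(2)[OF v] 1 in simp)
        ultimately show ?thesis using y by (metis disjoint_iff imageI)
      next
        case 2
        have cv: "c \<in> vectors (Lp p M)" using 2 C by blast
        define w where "w = Lp_class p M (\<lambda>t. (1 / \<eta>) *\<^sub>R (rep c t - rep y t))"
        have "(\<lambda>t. (1 / \<eta>) *\<^sub>R (rep c t - rep y t)) \<in> Lp_fun p M"
          using rep_in(2) cv yv \<open>0 < p\<close> by (intro Lp_fun_scaleR Lp_fun_diff) auto
        note w = rep_Lp_class[OF this, folded w_def]
        have cw: "AE t in M. rep c t = rep y t + \<eta> *\<^sub>R rep w t"
          using w(2) by eventually_elim (use \<open>\<eta> > 0\<close> in simp)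
        have "w \<in> shifted_cball (Lp p M) v \<epsilon>"
          using mem_shifted_cball_Lp[OF v \<open>\<epsilon> > 0\<close> \<open>0 < p\<close>] scale[OF 2(1) w(1) cv cw] 2(3) w(1) by simp
        moreover have "vadd (Lp p M) y (vscale (Lp p M) \<eta> w) = c"
          by (rule Lp_eqI[OF comb(1)[OF w(1)] cv]) (use comb(2)[OF w(1)] cw in \<open>eventually_elim, simp\<close>)
        ultimately show ?thesis using 2(2) by (metis disjoint_iff imageI)
      qed
    qed
  qed
  have ball: "y \<in> C \<inter> shifted_cball (Lp p M) x \<delta> \<longleftrightarrow>
      y \<in> C \<and> (\<integral>t. norm (rep y t - rep x t) powr p \<partial>M) \<le> \<delta> powr p" if "\<delta> > 0" for y \<delta>
    using mem_shifted_cball_Lp[OF x that \<open>0 < p\<close>] C by auto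
  have "(\<forall>y \<in> C \<inter> shifted_cball (Lp p M) x \<delta>. \<forall>\<eta>\<in>{0..\<kappa>}.
      C \<inter> (\<lambda>w. vadd (Lp p M) y (vscale (Lp p M) \<eta> w)) ` shifted_cball (Lp p M) v \<epsilon> \<noteq> {}) \<longleftrightarrow>
    (\<forall>y\<in>C. (\<integral>t. norm (rep y t - rep x t) powr p \<partial>M) \<le> \<delta> powr p \<longrightarrow>
      (\<forall>\<eta>\<in>{0<..\<kappa>}. \<exists>c\<in>C.
        (\<integral>t. norm (rep c t - rep y t - \<eta> *\<^sub>R rep v t) powr p \<partial>M) \<le> (\<eta> * \<epsilon>) powr p))"
    if "v \<in> vectors (Lp p M)" "\<epsilon> > 0" "\<delta> > 0" for \<epsilon> \<delta> \<kappa>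
    using step[OF that(1,2)] unfolding Ball_def[of "C \<inter> _"] ball[OF that(3)]
    by (smt (verit, ccfv_threshold) atLeastAtMost_iff greaterThanAtMost_iff)
  then show ?thesis
    unfolding clarke_cone_def mem_Collect_eq by (simp cong: conj_cong)
qed

lemma (in sigma_finite_measure) ex_positive_small_powr_integral:
  fixes p \<beta> :: real
  assumes "0 < p" "0 < \<beta>"
  obtains E where "E \<in> borel_measurable M" "\<And>t. t \<in> space M \<Longrightarrow> 0 < E t"
    "integrable M (\<lambda>t. E t powr p)" "(\<integral>t. E t powr p \<partial>M) \<le> \<beta>"
proof -
  obtain h where h [measurable]: "h \<in> borel_measurable M" and "integral\<^sup>N M h \<noteq> \<infinity>"
    and pos: "\<And>t. t \<in> space M \<Longrightarrow> 0 < h t \<and> h t < \<infinity>"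
    using Ex_finite_integrable_function by blast
  define g where "g t = enn2real (h t)" for t
  have [measurable]: "g \<in> borel_measurable M" unfolding g_def by measurable
  have g: "g t > 0" if "t \<in> space M" for t
    using pos[OF that] by (simp add: g_def enn2real_positive_iff)
  have "(\<integral>\<^sup>+t. ennreal (norm (g t)) \<partial>M) = integral\<^sup>N M h"
    by (rule nn_integral_cong) (use pos in \<open>auto simp: g_def less_top\<close>)
  then have int: "integrable M g"
    using \<open>integral\<^sup>N M h \<noteq> \<infinity>\<close> by (intro integrableI_bounded) (auto simp: less_top)
  define I where "I = integral\<^sup>L M g"
  have "I \<ge> 0" by (simp add: I_def g_def)
  define E where "E t = (\<beta> / (I + 1) * g t) powr (1 / p)" for t
  have E: "E t powr p = \<beta> / (I + 1) * g t" for t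
    using assms \<open>I \<ge> 0\<close> by (simp add: E_def powr_powr g_def)
  show ?thesis
  proof (rule that)
    show "E \<in> borel_measurable M" unfolding E_def by measurable
    show "0 < E t" if "t \<in> space M" for t
      using g[OF that] assms \<open>I \<ge> 0\<close> by (simp add: E_def)
    show "integrable M (\<lambda>t. E t powr p)" unfolding E using int by simp
    have "\<beta> * I \<le> \<beta> * (I + 1)" using assms by simp
    then show "(\<integral>t. E t powr p \<partial>M) \<le> \<beta>"
      unfolding E using \<open>I \<ge> 0\<close> by (simp add: I_def[symmetric] field_simps)
  qed
qed

subsection \<open>The cone of the selections\<close>

lemma Sel_subset_vectors: "Sel p M S \<subseteq> vectors (Lp p M)"
  by (auto simp: Sel_def)

lemma Lp_class_in_Sel:
  assumes "f \<in> Lp_fun p M" "AE t in M. f t \<in> S t"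
  shows "Lp_class p M f \<in> Sel p M S"
proof -
  have "AE t in M. rep (Lp_class p M f) t \<in> S t"
    using assms(2) rep_Lp_class(2)[OF assms(1)] by eventually_elim simp
  then show ?thesis using rep_Lp_class(1)[OF assms(1)] by (simp add: Sel_def)
qed

lemma Sel_clarke_cone_supset:
  fixes S :: "'t \<Rightarrow> 'z::{banach, second_countable_topology} set"
  assumes sf: "sigma_finite_measure M" and p: "1 \<le> p"
    and S: "measurable_multifunction M S" and x: "x \<in> Sel p M S"
    and v: "v \<in> vectors (Lp p M)"
    and cone: "AE t in M. rep v t \<in> clarke_cone type_space (S t) (rep x t)"
  shows "v \<in> clarke_cone (Lp p M) (Sel p M S) x"
proof -
  define X V where "X = rep x" and "V = rep v"
  have xv: "x \<in> vectors (Lp p M)" using x Sel_subset_vectors by blast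
  have Lp: "X \<in> Lp_fun p M" "V \<in> Lp_fun p M"
    using rep_in(2) xv v by (auto simp: X_def V_def)
  have [measurable]: "X \<in> borel_measurable M" "V \<in> borel_measurable M"
    using Lp by (auto simp: Lp_fun_def)
  have intV: "integrable M (\<lambda>t. norm (V t) powr p)" using Lp by (simp add: Lp_fun_def)
  have main: "\<exists>\<delta>>0. \<exists>\<kappa>>0. \<forall>y\<in>Sel p M S.
      (\<integral>t. norm (rep y t - X t) powr p \<partial>M) \<le> \<delta> powr p \<longrightarrow>
      (\<forall>\<eta>\<in>{0<..\<kappa>}. \<exists>c\<in>Sel p M S.
        (\<integral>t. norm (rep c t - rep y t - \<eta> *\<^sub>R V t) powr p \<partial>M) \<le> (\<eta> * \<epsilon>) powr p)"
    if "\<epsilon> > 0" for \<epsilon>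
  proof -
    define \<beta> where "\<beta> = \<epsilon> powr p / 3"
    have \<beta>: "\<beta> > 0" using that by (simp add: \<beta>_def)
    have "0 < p" using p by simp
    obtain E where [measurable]: "E \<in> borel_measurable M" and E: "\<And>t. t \<in> space M \<Longrightarrow> 0 < E t"
      "integrable M (\<lambda>t. E t powr p)" "(\<integral>t. E t powr p \<partial>M) \<le> \<beta>"
      using sigma_finite_measure.ex_positive_small_powr_integral[OF sf \<open>0 < p\<close> \<beta>] by blast
    define e where "e t = E t / 8" for t
    have [measurable]: "e \<in> borel_measurable M" unfolding e_def by measurable
    define G where "G j n t \<longleftrightarrow> clarke_good (S t) (X t) (V t) (inverse (Suc j)) (inverse (Suc n)) (e t)"
      for j n :: nat and t
    have [measurable]: "Measurable.pred M (G j n)" for j n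
      unfolding G_def by (rule measurable_clarke_good[OF S]) measurable
    define H where "H i t \<longleftrightarrow> (\<exists>j. (\<exists>\<^sub>F n in sequentially. G j n t) \<and>
      inverse (Suc i) * (1 + norm (V t) + 2 * e t) \<le> inverse (Suc j))" for i :: nat and t
    have [measurable]: "Measurable.pred M (H i)" for i
      unfolding H_def frequently_sequentially by measurable
    have H_ev: "AE t in M. \<forall>\<^sub>F i in sequentially. H i t"
      using cone AE_space
    proof eventually_elim
      case (elim t)
      have "e t > 0" using E(1)[OF elim(2)] by (simp add: e_def)
      then obtain j where "\<forall>\<^sub>F n in sequentially. G j n t"
        using clarke_cone_eventually_good elim(1) unfolding G_def X_def V_def by blast
      then have j: "\<exists>\<^sub>F n in sequentially. G j n t"
        by (rule eventually_frequently[rotated]) simp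
      have "(\<lambda>i. inverse (real (Suc i)) * (1 + norm (V t) + 2 * e t)) \<longlonglongrightarrow>
          0 * (1 + norm (V t) + 2 * e t)"
        by (intro tendsto_mult LIMSEQ_inverse_real_of_nat tendsto_const)
      then have "(\<lambda>i. inverse (real (Suc i)) * (1 + norm (V t) + 2 * e t)) \<longlonglongrightarrow> 0" by simp
      then have "\<forall>\<^sub>F i in sequentially.
          inverse (real (Suc i)) * (1 + norm (V t) + 2 * e t) < inverse (real (Suc j))"
        by (rule order_tendstoD(2)) simp
      then show ?case
        unfolding H_def by eventually_elim (use j in \<open>auto intro: less_imp_le\<close>)
    qed
    have "(\<lambda>i. \<integral>t. (if H i t then 0 else norm (V t) powr p) \<partial>M) \<longlonglongrightarrow> (\<integral>t. 0 \<partial>M)"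
    proof (rule integral_dominated_convergence[OF _ _ intV])
      show "AE t in M. (\<lambda>i. if H i t then 0 else norm (V t) powr p) \<longlonglongrightarrow> 0"
        using H_ev
      proof eventually_elim
        case (elim t)
        then have "\<forall>\<^sub>F i in sequentially. (if H i t then 0 else norm (V t) powr p) = 0"
          by eventually_elim simp
        then show ?case by (rule tendsto_eventually)
      qed
    qed auto
    then have "\<forall>\<^sub>F i in sequentially. (\<integral>t. (if H i t then 0 else norm (V t) powr p) \<partial>M) < \<beta>"
      using order_tendstoD(2)[of _ 0 sequentially \<beta>] \<beta> by simp
    then obtain i where i: "(\<integral>t. (if H i t then 0 else norm (V t) powr p) \<partial>M) < \<beta>"
      using eventually_sequentially by auto
    define s where "s = inverse (real (Suc i))"
    have "s > 0" by (simp add: s_def)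
    have Hi: "norm (V t) \<le> 1 / s" "y \<in> S t \<Longrightarrow> dist (X t) y < s \<Longrightarrow> 0 < \<eta> \<Longrightarrow> \<eta> \<le> s \<Longrightarrow>
        infdist (y + \<eta> *\<^sub>R V t) (S t) \<le> 3 * \<eta> * e t"
      if "H i t" and t: "t \<in> space M" for t y \<eta>
    proof -
      have "e t > 0" using E(1)[OF t] by (simp add: e_def)
      obtain j where j: "\<exists>\<^sub>F n in sequentially. G j n t"
        "s * (1 + norm (V t) + 2 * e t) \<le> inverse (Suc j)"
        using \<open>H i t\<close> by (auto simp: H_def s_def)
      have "s * norm (V t) \<le> s * (1 + norm (V t) + 2 * e t)"
        using \<open>e t > 0\<close> \<open>s > 0\<close> by (intro mult_left_mono) auto
      also have "\<dots> \<le> 1" using j(2) by (rule order_trans) (simp add: inverse_le_1_iff)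
      finally show "norm (V t) \<le> 1 / s" using \<open>s > 0\<close> by (simp add: field_simps)
      show "infdist (y + \<eta> *\<^sub>R V t) (S t) \<le> 3 * \<eta> * e t"
        if "y \<in> S t" "dist (X t) y < s" "0 < \<eta>" "\<eta> \<le> s"
        using clarke_good_multistep[OF j(1)[unfolded G_def] \<open>e t > 0\<close> that j(2)] .
    qed
    define \<delta> where "\<delta> = s\<^sup>2 * \<epsilon> / 3"
    have \<delta>: "\<delta> > 0" using \<open>s > 0\<close> \<open>\<epsilon> > 0\<close> by (simp add: \<delta>_def)
    have "\<delta> powr p / (s\<^sup>2) powr p = (\<epsilon> / 3) powr p"
      using \<open>s > 0\<close> \<open>\<epsilon> > 0\<close> by (simp add: \<delta>_def flip: powr_divide)
    also have "\<dots> = \<epsilon> powr p * (1 / 3) powr p"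
      using \<open>\<epsilon> > 0\<close> by (simp flip: powr_mult)
    also have "\<dots> \<le> \<epsilon> powr p * (1 / 3) powr 1"
      using p by (intro mult_left_mono powr_mono') auto
    finally have \<delta>\<beta>: "\<delta> powr p / (s\<^sup>2) powr p \<le> \<beta>" by (simp add: \<beta>_def)
    have "\<forall>y\<in>Sel p M S. (\<integral>t. norm (rep y t - X t) powr p \<partial>M) \<le> \<delta> powr p \<longrightarrow>
        (\<forall>\<eta>\<in>{0<..s}. \<exists>c\<in>Sel p M S.
          (\<integral>t. norm (rep c t - rep y t - \<eta> *\<^sub>R V t) powr p \<partial>M) \<le> (\<eta> * \<epsilon>) powr p)"
    proof (intro ballI impI)
      fix y \<eta>
      assume y: "y \<in> Sel p M S" "(\<integral>t. norm (rep y t - X t) powr p \<partial>M) \<le> \<delta> powr p"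
        and "\<eta> \<in> {0<..s}"
      then have \<eta>: "0 < \<eta>" "\<eta> \<le> s" by auto
      define Y where "Y = rep y"
      have YLp: "Y \<in> Lp_fun p M" using y rep_in(2) Sel_subset_vectors unfolding Y_def by blast
      have YS: "AE t in M. Y t \<in> S t" using y by (simp add: Sel_def Y_def)
      have [measurable]: "Y \<in> borel_measurable M" using YLp by (simp add: Lp_fun_def)
      have "(\<lambda>t. Y t + \<eta> *\<^sub>R V t) \<in> borel_measurable M" "(\<lambda>t. 4 * \<eta> * e t) \<in> borel_measurable M"
        by measurable
      then obtain w where [measurable]: "w \<in> borel_measurable M" and w: "\<And>t. t \<in> space M \<Longrightarrow>
          infdist (Y t + \<eta> *\<^sub>R V t) (S t) < 4 * \<eta> * e t \<Longrightarrow>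
          w t \<in> S t \<and> dist (Y t + \<eta> *\<^sub>R V t) (w t) \<le> 2 * (4 * \<eta> * e t)"
        using measurable_selection_near[OF S] by blast
      define c where "c t = (if H i t \<and> dist (X t) (Y t) < s then w t else Y t)" for t
      have [measurable]: "c \<in> borel_measurable M" unfolding c_def by measurable
      have w': "w t \<in> S t \<and> norm (w t - Y t - \<eta> *\<^sub>R V t) \<le> \<eta> * E t"
        if "t \<in> space M" "Y t \<in> S t" "H i t" "dist (X t) (Y t) < s" for t
      proof -
        have "infdist (Y t + \<eta> *\<^sub>R V t) (S t) \<le> 3 * \<eta> * e t"
          using Hi(2)[OF that(3,1,2,4) \<eta>] .
        also have "\<dots> < 4 * \<eta> * e t" using \<eta> E(1)[OF that(1)] by (simp add: e_def)
        finally have "w t \<in> S t \<and> dist (Y t + \<eta> *\<^sub>R V t) (w t) \<le> 2 * (4 * \<eta> * e t)"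
          using w that by blast
        then show ?thesis
          by (simp add: e_def dist_norm norm_minus_commute[of _ "w t"] diff_diff_eq)
      qed
      have cS: "AE t in M. c t \<in> S t"
        using YS AE_space by eventually_elim (use w' in \<open>auto simp: c_def\<close>)
      define B where "B t = \<eta> powr p * (E t powr p + (if H i t then 0 else norm (V t) powr p) +
        norm (Y t - X t) powr p / (s\<^sup>2) powr p)" for t
      have B_nonneg: "0 \<le> B t" for t by (simp add: B_def)
      have bound: "AE t in M. norm (c t - Y t - \<eta> *\<^sub>R V t) powr p \<le> B t"
        using YS AE_space
      proof eventually_elim
        case (elim t)
        consider (good) "H i t" "dist (X t) (Y t) < s" | (bad) "\<not> H i t"
          | (far) "H i t" "s \<le> dist (X t) (Y t)" by linarith
        then show ?case
        proof cases
          case good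
          have "norm (c t - Y t - \<eta> *\<^sub>R V t) powr p \<le> (\<eta> * E t) powr p"
            using w'[OF elim(2,1) good] good p by (intro powr_mono2) (auto simp: c_def)
          also have "\<dots> \<le> B t" using \<eta> E(1)[OF elim(2)] by (simp add: B_def powr_mult)
          finally show ?thesis .
        next
          case bad
          then show ?thesis using \<eta> by (simp add: c_def B_def powr_mult)
        next
          case far
          have "norm (V t) \<le> 1 / s" using Hi(1)[OF far(1) elim(2)] .
          also have "\<dots> = s / s\<^sup>2" by (simp add: power2_eq_square)
          also have "\<dots> \<le> norm (Y t - X t) / s\<^sup>2"
            using far(2) by (intro divide_right_mono) (auto simp: dist_norm norm_minus_commute)
          finally have "norm (V t) powr p \<le> (norm (Y t - X t) / s\<^sup>2) powr p"
            using p by (intro powr_mono2) auto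
          then have "norm (V t) powr p \<le> norm (Y t - X t) powr p / (s\<^sup>2) powr p"
            by (simp add: powr_divide)
          then have "\<eta> powr p * norm (V t) powr p \<le> B t"
            unfolding B_def by (intro mult_left_mono) (auto intro: add_increasing)
          then show ?thesis using far \<eta> by (simp add: c_def powr_mult)
        qed
      qed
      have intYX: "integrable M (\<lambda>t. norm (Y t - X t) powr p)"
        using Lp_fun_diff[OF YLp Lp(1)] p by (simp add: Lp_fun_def)
      have intH: "integrable M (\<lambda>t. if H i t then 0 else norm (V t) powr p)"
        by (rule Bochner_Integration.integrable_bound[OF intV]) auto
      have intB: "integrable M B" unfolding B_def
        using E(2) intH intYX by (intro integrable_mult_right Bochner_Integration.integrable_add) auto
      have int: "integrable M (\<lambda>t. norm (c t - Y t - \<eta> *\<^sub>R V t) powr p)"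
      proof (rule Bochner_Integration.integrable_bound[OF intB])
        show "AE t in M. norm (norm (c t - Y t - \<eta> *\<^sub>R V t) powr p) \<le> norm (B t)"
          using bound by eventually_elim simp
      qed auto
      have "integral\<^sup>L M B = \<eta> powr p * ((\<integral>t. E t powr p \<partial>M) +
          (\<integral>t. (if H i t then 0 else norm (V t) powr p) \<partial>M) +
          (\<integral>t. norm (Y t - X t) powr p \<partial>M) / (s\<^sup>2) powr p)"
        unfolding B_def using E(2) intH intYX by simp
      also have "\<dots> \<le> \<eta> powr p * (\<beta> + \<beta> + \<beta>)"
      proof (intro mult_left_mono add_mono)
        have "(\<integral>t. norm (Y t - X t) powr p \<partial>M) / (s\<^sup>2) powr p \<le> \<delta> powr p / (s\<^sup>2) powr p"
          using y(2) by (intro divide_right_mono) (auto simp: Y_def)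
        then show "(\<integral>t. norm (Y t - X t) powr p \<partial>M) / (s\<^sup>2) powr p \<le> \<beta>"
          using \<delta>\<beta> by linarith
      qed (use E(3) i in auto)
      also have "\<dots> = (\<eta> * \<epsilon>) powr p" using \<eta> \<open>\<epsilon> > 0\<close> by (simp add: \<beta>_def powr_mult)
      finally have B_le: "integral\<^sup>L M B \<le> (\<eta> * \<epsilon>) powr p" .
      have "(\<lambda>t. c t - Y t - \<eta> *\<^sub>R V t) \<in> Lp_fun p M" using int by (simp add: Lp_fun_def)
      from Lp_fun_add[OF this Lp_fun_add[OF YLp Lp_fun_scaleR[OF Lp(2), of \<eta>]]]
      have cLp: "c \<in> Lp_fun p M" using p by simp
      define u where "u = Lp_class p M c"
      have u: "u \<in> Sel p M S" unfolding u_def by (rule Lp_class_in_Sel[OF cLp cS])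
      have [measurable]: "rep u \<in> borel_measurable M"
        using u Sel_subset_vectors rep_measurable by blast
      have "AE t in M. norm (rep u t - rep y t - \<eta> *\<^sub>R V t) powr p \<le> B t"
        using rep_Lp_class(2)[OF cLp] bound unfolding u_def Y_def by eventually_elim simp
      then have "(\<integral>t. norm (rep u t - rep y t - \<eta> *\<^sub>R V t) powr p \<partial>M) \<le> integral\<^sup>L M B"
        using intB B_nonneg by (intro integral_mono_AE') auto
      then show "\<exists>c\<in>Sel p M S.
          (\<integral>t. norm (rep c t - rep y t - \<eta> *\<^sub>R V t) powr p \<partial>M) \<le> (\<eta> * \<epsilon>) powr p"
        using u B_le by (intro bexI[of _ u]) auto
    qed
    then show ?thesis using \<delta> \<open>s > 0\<close> by blast
  qed
  then show ?thesis
    using clarke_cone_Lp_iff[OF Sel_subset_vectors xv] p v unfolding X_def V_def by simp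
qed

lemma Sel_clarke_cone_subset:
  fixes S :: "'t \<Rightarrow> 'z::{banach, second_countable_topology} set"
  assumes sf: "sigma_finite_measure M" and p: "1 \<le> p"
    and S: "measurable_multifunction M S" and x: "x \<in> Sel p M S"
    and v: "v \<in> clarke_cone (Lp p M) (Sel p M S) x"
  shows "v \<in> vectors (Lp p M)"
    and "AE t in M. rep v t \<in> clarke_cone type_space (S t) (rep x t)"
proof -
  have "0 < p" using p by simp
  define X V where "X = rep x" and "V = rep v"
  have xv: "x \<in> vectors (Lp p M)" using x Sel_subset_vectors by blast
  note iff = clarke_cone_Lp_iff[OF Sel_subset_vectors xv \<open>0 < p\<close>, THEN iffD1, OF v,
      folded X_def V_def]
  show vv: "v \<in> vectors (Lp p M)" using iff by blast
  have Lp: "X \<in> Lp_fun p M" "V \<in> Lp_fun p M"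
    using rep_in(2) xv vv by (auto simp: X_def V_def)
  have [measurable]: "X \<in> borel_measurable M" "V \<in> borel_measurable M"
    using Lp by (auto simp: Lp_fun_def)
  have XS: "AE t in M. X t \<in> S t" using x by (simp add: Sel_def X_def)
  define G where "G m j n t \<longleftrightarrow> clarke_good (S t) (X t) (V t)
    (inverse (Suc j)) (inverse (Suc n)) (inverse (Suc m))" for m j n :: nat and t
  have [measurable]: "Measurable.pred M (G m j n)" for m j n
    unfolding G_def by (rule measurable_clarke_good[OF S]) measurable
  have main: "AE t in M. \<exists>j. \<exists>\<^sub>F n in sequentially. G m j n t" for m
  proof (rule ccontr)
    assume not_AE: "\<not> (AE t in M. \<exists>j. \<exists>\<^sub>F n in sequentially. G m j n t)"
    define \<epsilon> where "\<epsilon> = inverse (real (Suc m))"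
    have "\<epsilon> > 0" by (simp add: \<epsilon>_def)
    define B where "B = {t \<in> space M. \<not> (\<exists>j. \<exists>\<^sub>F n in sequentially. G m j n t)}"
    have [measurable]: "B \<in> sets M" unfolding B_def frequently_sequentially by measurable
    have "emeasure M B \<noteq> 0"
      using not_AE AE_iff_measurable[OF \<open>B \<in> sets M\<close> B_def[symmetric]] by metis
    obtain A :: "nat \<Rightarrow> 't set" where A: "range A \<subseteq> sets M" "(\<Union>i. A i) = space M"
      "\<And>i. emeasure M (A i) \<noteq> \<infinity>"
      using sigma_finite_measure.sigma_finite[OF sf] by blast
    have "\<exists>i. emeasure M (B \<inter> A i) \<noteq> 0"
    proof (rule ccontr)
      assume "\<not> (\<exists>i. emeasure M (B \<inter> A i) \<noteq> 0)"
      then have "emeasure M (\<Union>i. B \<inter> A i) = 0"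
        using A(1) by (intro emeasure_UN_eq_0) auto
      moreover have "(\<Union>i. B \<inter> A i) = B" using A(2) by (auto simp: B_def)
      ultimately show False using \<open>emeasure M B \<noteq> 0\<close> by simp
    qed
    then obtain i where i: "emeasure M (B \<inter> A i) \<noteq> 0" by blast
    define D where "D = B \<inter> A i"
    have [measurable]: "D \<in> sets M" using A(1) unfolding D_def by auto
    have "emeasure M D \<le> emeasure M (A i)"
      using A(1) unfolding D_def by (intro emeasure_mono) auto
    then have Dfin: "emeasure M D \<noteq> \<infinity>" using A(3)[of i] by (auto simp: top_unique)
    define a where "a = measure M D"
    have "a > 0"
      using i Dfin unfolding a_def D_def[symmetric]
      by (metis emeasure_eq_ennreal_measure ennreal_0 infinity_ennreal_def measure_nonneg not_less order_le_less)
    define \<gamma> where "\<gamma> = \<epsilon> * (a / 2) powr (1 / p)"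
    have "\<gamma> > 0" using \<open>\<epsilon> > 0\<close> \<open>a > 0\<close> by (simp add: \<gamma>_def)
    obtain \<delta> \<kappa> where "\<delta> > 0" "\<kappa> > 0" and near: "\<forall>y\<in>Sel p M S.
      (\<integral>t. norm (rep y t - X t) powr p \<partial>M) \<le> \<delta> powr p \<longrightarrow>
      (\<forall>\<eta>\<in>{0<..\<kappa>}. \<exists>c\<in>Sel p M S.
        (\<integral>t. norm (rep c t - rep y t - \<eta> *\<^sub>R V t) powr p \<partial>M) \<le> (\<eta> * \<gamma>) powr p)"
      using iff[THEN conjunct2, THEN spec[of _ \<gamma>], THEN mp[OF _ \<open>\<gamma> > 0\<close>]]
      by (elim exE conjE) (rule that; assumption)
    obtain j where j: "inverse (real (Suc j)) < \<delta> / a powr (1 / p)"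
      using reals_Archimedean[of "\<delta> / a powr (1 / p)"] \<open>\<delta> > 0\<close> \<open>a > 0\<close> by auto
    define r where "r = inverse (real (Suc j))"
    have "r > 0" by (simp add: r_def)
    have "r * a powr (1 / p) \<le> \<delta>" using j \<open>a > 0\<close> by (simp add: r_def field_simps)
    then have "(r * a powr (1 / p)) powr p \<le> \<delta> powr p"
      using p \<open>r > 0\<close> by (intro powr_mono2) auto
    then have ra: "r powr p * a \<le> \<delta> powr p"
      using p \<open>r > 0\<close> \<open>a > 0\<close> by (simp add: powr_mult powr_powr)
    define F where "F k = {t \<in> D. \<forall>n\<ge>k. \<not> G m j n t}" for k
    have [measurable]: "F k \<in> sets M" for k
      unfolding F_def by measurable
    have "(\<Union>k. F k) = D"
      by (auto simp: F_def D_def B_def not_frequently eventually_sequentially)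
    moreover have "range F \<subseteq> sets M" by auto
    moreover have "incseq F" by (auto simp: incseq_def F_def)
    ultimately have "(\<lambda>k. measure M (F k)) \<longlonglongrightarrow> a"
      using Lim_measure_incseq[of F M] Dfin unfolding a_def by auto
    then have "\<forall>\<^sub>F k in sequentially. a / 2 < measure M (F k)"
      by (rule order_tendstoD(1)) (use \<open>a > 0\<close> in simp)
    moreover have "\<forall>\<^sub>F k in sequentially. inverse (real (Suc k)) < \<kappa>"
      using order_tendstoD(2)[OF LIMSEQ_inverse_real_of_nat \<open>\<kappa> > 0\<close>] .
    ultimately have "\<forall>\<^sub>F k in sequentially. a / 2 < measure M (F k) \<and> inverse (real (Suc k)) < \<kappa>"
      by eventually_elim simp
    then obtain k where k: "a / 2 < measure M (F k)" "inverse (real (Suc k)) < \<kappa>"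
      using eventually_sequentially by auto
    define \<eta> where "\<eta> = inverse (real (Suc k))"
    have \<eta>: "\<eta> > 0" "\<eta> \<in> {0<..\<kappa>}" using k by (auto simp: \<eta>_def)
    have Fle: "emeasure M (F k) \<le> emeasure M D"
      by (intro emeasure_mono) (auto simp: F_def)
    then have Ffin: "emeasure M (F k) < \<infinity>" using Dfin by (simp add: less_top order_le_less_trans)
    have "measure M (F k) \<le> a"
      unfolding a_def measure_def using Fle Dfin by (intro enn2real_mono) (auto simp: less_top)
    obtain y0 where [measurable]: "y0 \<in> borel_measurable M" and "\<forall>t\<in>space M.
        \<not> clarke_good (S t) (X t) (V t) r \<eta> \<epsilon> \<longrightarrow> y0 t \<in> S t \<and> dist (X t) (y0 t) < r \<and>
        infdist (y0 t + \<eta> *\<^sub>R V t) (S t) > \<eta> * \<epsilon>"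
      using measurable_selection_not_good[OF S, of X V "\<lambda>_. \<epsilon>" r \<eta>] by auto
    moreover have "t \<in> space M \<and> \<not> clarke_good (S t) (X t) (V t) r \<eta> \<epsilon>" if "t \<in> F k" for t
      using that by (auto simp: F_def G_def D_def B_def r_def \<eta>_def \<epsilon>_def)
    ultimately have y0: "y0 t \<in> S t \<and> dist (X t) (y0 t) < r \<and>
        infdist (y0 t + \<eta> *\<^sub>R V t) (S t) > \<eta> * \<epsilon>" if "t \<in> F k" for t
      using that by blast
    define Y where "Y t = (if t \<in> F k then y0 t else X t)" for t
    have [measurable]: "Y \<in> borel_measurable M" unfolding Y_def by measurable
    have YS: "AE t in M. Y t \<in> S t" using XS by eventually_elim (use y0 in \<open>auto simp: Y_def\<close>)
    have YX: "norm (Y t - X t) powr p \<le> r powr p * indicator (F k) t" for t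
      using y0[of t] p by (auto simp: Y_def dist_norm norm_minus_commute intro!: powr_mono2)
    have intF: "integrable M (\<lambda>t. C * indicator (F k) t :: real)" for C
      using Ffin by simp
    have "integrable M (\<lambda>t. norm (Y t - X t) powr p)"
      by (rule Bochner_Integration.integrable_bound[OF intF[of "r powr p"]]) (use YX in auto)
    then have "(\<lambda>t. Y t - X t) \<in> Lp_fun p M" by (simp add: Lp_fun_def)
    from Lp_fun_add[OF this Lp(1)] have YLp: "Y \<in> Lp_fun p M" using p by simp
    define y where "y = Lp_class p M Y"
    have y: "y \<in> Sel p M S" unfolding y_def by (rule Lp_class_in_Sel[OF YLp YS])
    note yY = rep_Lp_class(2)[OF YLp, folded y_def]
    have [measurable]: "rep y \<in> borel_measurable M"
      using y Sel_subset_vectors rep_measurable by blast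
    have "AE t in M. norm (rep y t - X t) powr p \<le> r powr p * indicator (F k) t"
      using yY by eventually_elim (use YX in simp)
    then have "(\<integral>t. norm (rep y t - X t) powr p \<partial>M) \<le> (\<integral>t. r powr p * indicator (F k) t \<partial>M)"
      using intF by (intro integral_mono_AE') auto
    also have "\<dots> = r powr p * measure M (F k)" by simp
    also have "\<dots> \<le> r powr p * a" using \<open>measure M (F k) \<le> a\<close> by (intro mult_left_mono) auto
    finally have "(\<integral>t. norm (rep y t - X t) powr p \<partial>M) \<le> \<delta> powr p" using ra by linarith
    then obtain c where c: "c \<in> Sel p M S"
      "(\<integral>t. norm (rep c t - rep y t - \<eta> *\<^sub>R V t) powr p \<partial>M) \<le> (\<eta> * \<gamma>) powr p"
      using near y \<eta>(2) by blast
    have cv: "c \<in> vectors (Lp p M)" "y \<in> vectors (Lp p M)" using c y Sel_subset_vectors by blast+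
    have "AE t in M. (\<eta> * \<epsilon>) powr p * indicator (F k) t \<le>
        norm (rep c t - rep y t - \<eta> *\<^sub>R V t) powr p"
      using yY c(1)[unfolded Sel_def mem_Collect_eq, THEN conjunct2]
    proof eventually_elim
      case (elim t)
      show ?case
      proof (cases "t \<in> F k")
        case True
        then have "\<eta> * \<epsilon> < infdist (rep y t + \<eta> *\<^sub>R V t) (S t)"
          using y0[OF True] elim(1) by (simp add: Y_def)
        also have "\<dots> \<le> dist (rep y t + \<eta> *\<^sub>R V t) (rep c t)" by (rule infdist_le[OF elim(2)])
        also have "\<dots> = norm (rep c t - rep y t - \<eta> *\<^sub>R V t)"
          by (simp add: dist_norm norm_minus_commute[of _ "rep c t"] diff_diff_eq)
        finally show ?thesis using True p \<eta> \<open>\<epsilon> > 0\<close> by (auto intro!: powr_mono2)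
      qed simp
    qed
    moreover have "(\<lambda>t. rep c t - rep y t - \<eta> *\<^sub>R V t) \<in> Lp_fun p M"
      using rep_in(2) cv Lp p by (intro Lp_fun_diff Lp_fun_scaleR) auto
    ultimately have "(\<integral>t. (\<eta> * \<epsilon>) powr p * indicator (F k) t \<partial>M) \<le>
        (\<integral>t. norm (rep c t - rep y t - \<eta> *\<^sub>R V t) powr p \<partial>M)"
      using intF by (intro integral_mono_AE) (auto simp: Lp_fun_def)
    also have "\<dots> \<le> (\<eta> * \<gamma>) powr p" by (rule c(2))
    also have "\<dots> = (\<eta> * \<epsilon>) powr p * (a / 2)"
      using \<open>a > 0\<close> \<eta> \<open>\<epsilon> > 0\<close> p by (simp add: \<gamma>_def powr_mult powr_powr)
    finally have "(\<eta> * \<epsilon>) powr p * measure M (F k) \<le> (\<eta> * \<epsilon>) powr p * (a / 2)" by simp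
    then show False using k(1) \<eta> \<open>\<epsilon> > 0\<close> by (simp add: mult_le_cancel_left_pos)
  qed
  then have "AE t in M. \<forall>m. \<exists>j. \<exists>\<^sub>F n in sequentially. G m j n t"
    by (simp add: AE_all_countable)
  then show "AE t in M. rep v t \<in> clarke_cone type_space (S t) (rep x t)"
    by eventually_elim (auto simp: G_def X_def V_def intro!: clarke_coneI_frequently_good)
qed

theorem theorem1:
  fixes M :: "'t measure"
    and p :: real
    and S :: "'t \<Rightarrow> 'z::{banach, second_countable_topology} set"
    and x :: "('t \<Rightarrow> 'z) set"
  assumes "complete_measure M" and "sigma_finite_measure M"
    and "1 \<le> p"
    and "measurable_multifunction M S"
    and "x \<in> Sel p M S"
  shows "clarke_cone (Lp p M) (Sel p M S) x =
    {v \<in> vectors (Lp p M). AE t in M. rep v t \<in> clarke_cone type_space (S t) (rep x t)}"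
  using Sel_clarke_cone_subset[OF assms(2-5)] Sel_clarke_cone_supset[OF assms(2-5)] by blast

end
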